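(* Let $G$ be an infinite locally finite group. If every proper subgroup of $G$ admits an inverse ambiguous automorphism, then $G$ admits an inverse ambiguous automorphism $\alpha$ that leaves every subgroup of $G$ invariant, i.e. $\alpha(H)=H$ for every subgroup $H\leq G$. In particular, $G$ is abelian.
   Context: A group is locally finite if each of its finitely generated subgroups is finite. A bijection $f$ of a group $G$ onto itself is called inverse ambiguous if $f^{-1}(x)=f(x)^{-1}$ for every $x\in G$, where $f^{-1}(x)$ is the preimage of $x$ under $f$ and $f(x)^{-1}$ is the group inverse of $f(x)$. An inverse ambiguous automorphism is a group automorphism that is inverse ambiguous. *)

theory Defs
  imports "HOL-Algebra.Algebra"
begin

(* The finitely generated subgroups of G are exactly the sets generate G S
   with S a finite subset of the carrier. *)
definition locally_finite :: "('a, 'b) monoid_scheme \<Rightarrow> bool" where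
  "locally_finite G \<longleftrightarrow>
     (\<forall>S. finite S \<and> S \<subseteq> carrier G \<longrightarrow> finite (generate G S))"

(* Maps are total functions on the ambient type; only their values on the
   carrier matter, so the preimage of x under f is taken inside the carrier. *)
definition inverse_ambiguous :: "('a, 'b) monoid_scheme \<Rightarrow> ('a \<Rightarrow> 'a) \<Rightarrow> bool" where
  "inverse_ambiguous G f \<longleftrightarrow>
     bij_betw f (carrier G) (carrier G) \<and>
     (\<forall>x\<in>carrier G. inv_into (carrier G) f x = inv\<^bsub>G\<^esub> (f x))"

definition inverse_ambiguous_automorphism ::
    "('a, 'b) monoid_scheme \<Rightarrow> ('a \<Rightarrow> 'a) \<Rightarrow> bool" where
  "inverse_ambiguous_automorphism G f \<longleftrightarrow> f \<in> iso G G \<and> inverse_ambiguous G f"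

end

theory Submission
  imports Defs "HOL-Number_Theory.Cong"
begin

text \<open>
  An automorphism \<open>f\<close> is inverse ambiguous iff \<open>f (f x) = x\<^sup>-\<^sup>1\<close> for all \<open>x\<close>. Hence inversion is an
  automorphism of every finite subgroup of \<open>G\<close>, all of which are proper, so any two elements of
  \<open>G\<close> commute. On a cyclic subgroup of order \<open>n\<close> such an \<open>f\<close> is the power map of a square root
  of \<open>-1\<close> modulo \<open>n\<close>. The moduli admitting a square root of \<open>-1\<close> are closed under least common
  multiples, so by a compactness argument one can choose compatible square roots for all of them
  at once; raising every element to the root that belongs to its order is the required \<open>\<alpha>\<close>.
\<close>

section \<open>Square roots of \<open>-1\<close>\<close>

text \<open>Prepares for the Chinese remainder theorem. Strip a prime \<open>p\<close> from both
  numbers, split the \<open>p\<close>-free parts by induction, then return the higher of the two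
  powers of \<open>p\<close>.\<close>

lemma coprime_lcm_split:
  fixes m n :: nat
  assumes "m > 0" "n > 0"
  shows "\<exists>a b. coprime a b \<and> a dvd m \<and> b dvd n \<and> lcm m n dvd a * b"
  using assms
proof (induction m arbitrary: n rule: less_induct)
  case (less m)
  show ?case
  proof (cases "m = 1")
    case True
    then show ?thesis by (intro exI[of _ 1] exI[of _ n]) auto
  next
    case False
    then obtain p where p: "normalization_semidom_class.prime p" "p dvd m" using prime_factor_nat by blast
    have np: "\<not> is_unit p" using p(1) not_prime_unit by blast
    obtain m' where m': "m = p ^ multiplicity p m * m'" "\<not> p dvd m'"
      using multiplicity_decompose'[of m p] less.prems np by auto
    obtain n' where n': "n = p ^ multiplicity p n * n'" "\<not> p dvd n'"
      using multiplicity_decompose'[of n p] less.prems np by auto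
    define i j where "i = multiplicity p m" and "j = multiplicity p n"
    have mi: "m = p ^ i * m'" and nj: "n = p ^ j * n'"
      using m' n' by (auto simp: i_def j_def)
    have pos: "m' > 0" "n' > 0" using mi nj less.prems by (auto intro: Nat.gr0I)
    have "m' < m"
      using p m' pos mi by (metis dvd_imp_le dvd_triv_right le_neq_implies_less less.prems(1))
    then obtain a b where ab: "coprime a b" "a dvd m'" "b dvd n'" "lcm m' n' dvd a * b"
      using less.IH pos by blast
    have "\<not> p dvd a" "\<not> p dvd b" using ab m' n' dvd_trans by blast+
    then have cop: "coprime (p ^ k) a" "coprime (p ^ k) b" for k
      using p(1) by (auto simp: prime_imp_coprime)
    have dvd: "m' dvd a * b" "n' dvd a * b" using ab by auto
    show ?thesis
    \<comment> \<open>The higher power of \<open>p\<close> goes to the factor belonging to the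
      number it came from, so that this factor still divides that number.\<close>
    proof (cases "j \<le> i")
      case True
      then have "p ^ j dvd p ^ i" by (rule le_imp_power_dvd)
      then have "m dvd (p ^ i * a) * b" "n dvd (p ^ i * a) * b"
        unfolding mi nj mult.assoc by (auto intro: mult_dvd_mono dvd)
      moreover have "coprime (p ^ i * a) b" using cop ab by simp
      ultimately show ?thesis using ab mi nj
        by (intro exI[of _ "p ^ i * a"] exI[of _ b]) (auto intro: mult_dvd_mono)
    next
      case False
      then have "p ^ i dvd p ^ j" by (intro le_imp_power_dvd) simp
      then have "m dvd p ^ j * (a * b)" "n dvd p ^ j * (a * b)"
        unfolding mi nj by (auto intro: mult_dvd_mono dvd)
      moreover have "coprime a (p ^ j * b)" using cop ab by (simp add: coprime_commute)
      ultimately show ?thesis using ab mi nj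
        by (intro exI[of _ a] exI[of _ "p ^ j * b"]) (auto intro: mult_dvd_mono simp: mult.left_commute)
    qed
  qed
qed

lemma dvd_square_plus_one_cong:
  fixes n k l :: nat
  assumes "n dvd k\<^sup>2 + 1" "[k = l] (mod n)"
  shows "n dvd l\<^sup>2 + 1"
  using assms by (metis cong_add_rcancel_nat cong_dvd_iff cong_pow)

text \<open>\<open>k\<close> and \<open>l\<close> may disagree modulo \<open>gcd m n\<close>, so
  they cannot be glued directly. They are glued modulo coprime divisors \<open>a\<close> of
  \<open>m\<close> and \<open>b\<close> of \<open>n\<close> instead, which already account for the
  whole lcm.\<close>

lemma square_root_minus_one_lcm:
  fixes m n k l :: nat
  assumes "m > 0" "n > 0" "m dvd k\<^sup>2 + 1" "n dvd l\<^sup>2 + 1"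
  shows "\<exists>r. lcm m n dvd r\<^sup>2 + 1"
proof -
  obtain a b where ab: "coprime a b" "a dvd m" "b dvd n" "lcm m n dvd a * b"
    using coprime_lcm_split assms by blast
  obtain r where "[r = k] (mod a)" "[r = l] (mod b)"
    using binary_chinese_remainder_nat[OF ab(1)] by blast
  then have "a dvd r\<^sup>2 + 1" "b dvd r\<^sup>2 + 1"
    using ab assms by (meson cong_sym dvd_square_plus_one_cong dvd_trans)+
  then show ?thesis using ab by (meson divides_mult dvd_trans)
qed

lemma square_root_minus_one_Lcm:
  fixes A :: "nat set"
  assumes "finite A" "\<And>n. n \<in> A \<Longrightarrow> n > 0 \<and> (\<exists>k. n dvd k\<^sup>2 + 1)"
  shows "Lcm A > 0 \<and> (\<exists>k. Lcm A dvd k\<^sup>2 + 1)"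
  using assms
proof (induction A rule: finite_induct)
  case (insert n A)
  then have "n > 0" "Lcm A > 0" "\<exists>k. n dvd k\<^sup>2 + 1" "\<exists>k. Lcm A dvd k\<^sup>2 + 1" by auto
  then show ?case using square_root_minus_one_lcm by (auto simp: lcm_pos_nat)
qed auto

text \<open>Koenig's lemma: the residue \<open>r j\<close> is kept in a class met by infinitely many of the
  given roots \<open>K l\<close>.\<close>

lemma compatible_square_roots_chain:
  fixes N :: "nat \<Rightarrow> nat"
  assumes pos: "\<And>j. N j > 0" and chain: "\<And>i j. i \<le> j \<Longrightarrow> N i dvd N j"
    and root: "\<And>j. \<exists>k. N j dvd k\<^sup>2 + 1"
  shows "\<exists>r. (\<forall>j. N j dvd (r j)\<^sup>2 + 1) \<and> (\<forall>i j. i \<le> j \<longrightarrow> [r j = r i] (mod N i))"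
proof -
  obtain K where K: "\<And>j. N j dvd (K j)\<^sup>2 + 1" using root by metis
  have refine: "\<exists>s. infinite {l \<in> S. [K l = s] (mod N j)}" if "infinite S" for S j
  proof -
    have "finite ((\<lambda>l. K l mod N j) ` S)"
      by (rule finite_subset[of _ "{..<N j}"]) (use pos in auto)
    from pigeonhole_infinite[OF that this] obtain l0
      where "infinite {l \<in> S. K l mod N j = K l0 mod N j}" by auto
    then show ?thesis unfolding cong_def by blast
  qed
  define Q where "Q j s = infinite {l. [K l = s] (mod N j)}" for j s
  have "\<exists>r. \<forall>j. Q j (r j) \<and> [r (Suc j) = r j] (mod N j)"
  proof (rule dependent_nat_choice)
    show "\<exists>s. Q 0 s" using refine[of UNIV 0] by (auto simp: Q_def)
  next
    fix s j
    assume "Q j s"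
    then obtain t where t: "infinite {l \<in> {l. [K l = s] (mod N j)}. [K l = t] (mod N (Suc j))}"
      using refine unfolding Q_def by blast
    \<comment> \<open>A single index in both classes suffices to compare \<open>t\<close> with
      \<open>s\<close> modulo \<open>N j\<close>.\<close>
    then obtain l where l: "[K l = s] (mod N j)" "[K l = t] (mod N (Suc j))"
      using not_finite_existsD by auto
    have "[K l = t] (mod N j)"
      by (rule cong_dvd_modulus_nat[OF l(2) chain]) simp
    then have "[t = s] (mod N j)"
      using l(1) cong_sym cong_trans by blast
    moreover have "Q (Suc j) t"
      unfolding Q_def by (rule infinite_super[OF _ t]) auto
    ultimately show "\<exists>t. Q (Suc j) t \<and> [t = s] (mod N j)" by blast
  qed
  then obtain r where Q: "\<And>j. Q j (r j)" and step_cong: "\<And>j. [r (Suc j) = r j] (mod N j)" by blast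
  have "N j dvd (r j)\<^sup>2 + 1" for j
  proof -
    \<comment> \<open>An infinite class contains some \<open>l\<close> beyond \<open>j\<close>;
      there \<open>N j\<close> divides \<open>N l\<close>, so \<open>K l\<close> is a root modulo
      \<open>N j\<close> as well.\<close>
    obtain l where "l \<ge> j" "[K l = r j] (mod N j)"
      using Q[of j] unfolding Q_def infinite_nat_iff_unbounded_le by auto
    then show ?thesis
      using dvd_square_plus_one_cong[OF dvd_trans[OF chain K]] by blast
  qed
  moreover have "[r j = r i] (mod N i)" if "i \<le> j" for i j
    using that
  proof (induction j rule: dec_induct)
    case (step n)
    then show ?case using cong_dvd_modulus_nat[OF step_cong chain[OF step.hyps(1)]] cong_trans by blast
  qed simp
  ultimately show ?thesis by blast
qed

text \<open>Reduces the divisibility order to a chain: \<open>N j\<close> is the lcm of all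
  admissible moduli up to \<open>j\<close>, so an admissible \<open>n\<close> divides
  \<open>N n\<close> and can use the root at index \<open>n\<close>.\<close>

lemma compatible_square_roots:
  "\<exists>r :: nat \<Rightarrow> nat. \<forall>n>0. (\<exists>k. n dvd k\<^sup>2 + 1) \<longrightarrow>
     n dvd (r n)\<^sup>2 + 1 \<and> (\<forall>m. m dvd n \<longrightarrow> [r n = r m] (mod m))"
proof -
  define A where "A j = {n. 0 < n \<and> n \<le> j \<and> (\<exists>k::nat. n dvd k\<^sup>2 + 1)}" for j :: nat
  define N where "N j = Lcm (A j)" for j
  have fin: "finite (A j)" for j
    by (rule finite_subset[of _ "{..j}"]) (auto simp: A_def)
  have "N j > 0 \<and> (\<exists>k. N j dvd k\<^sup>2 + 1)" for j
    unfolding N_def using fin by (rule square_root_minus_one_Lcm) (auto simp: A_def)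
  moreover have "N i dvd N j" if "i \<le> j" for i j
    unfolding N_def using that by (intro Lcm_subset) (auto simp: A_def)
  ultimately obtain r where r: "\<And>j. N j dvd (r j)\<^sup>2 + 1"
      "\<And>i j. i \<le> j \<Longrightarrow> [r j = r i] (mod N i)"
    using compatible_square_roots_chain[of N] by blast
  have "n dvd (r n)\<^sup>2 + 1 \<and> (\<forall>m. m dvd n \<longrightarrow> [r n = r m] (mod m))"
    if n: "n > 0" "\<exists>k. n dvd k\<^sup>2 + 1" for n
  proof -
    have dvdN: "m dvd N m" if "m dvd n" for m
    proof -
      \<comment> \<open>Divisors of an admissible modulus are admissible, with the same
        root.\<close>
      have "m \<in> A m" using n that dvd_trans by (auto simp: A_def intro: Nat.gr0I)
      then show ?thesis unfolding N_def by (rule dvd_Lcm)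
    qed
    have "[r n = r m] (mod m)" if "m dvd n" for m
      using cong_dvd_modulus_nat[OF r(2) dvdN[OF that]] that n dvd_imp_le by blast
    moreover have "n dvd (r n)\<^sup>2 + 1" using dvd_trans[OF dvdN r(1)] by simp
    ultimately show ?thesis by blast
  qed
  then show ?thesis by blast
qed

section \<open>Inverse ambiguous automorphisms\<close>

context group
begin

text \<open>Applying \<open>f\<close> to the defining equation removes the preimage. Conversely,
  bijectivity comes for free, since \<open>inv (f x)\<close> gives a two-sided inverse of
  \<open>f\<close>.\<close>

lemma inverse_ambiguous_automorphism_iff:
  "inverse_ambiguous_automorphism G f \<longleftrightarrow>
     f \<in> hom G G \<and> (\<forall>x\<in>carrier G. f (f x) = inv x)"
proof
  assume "inverse_ambiguous_automorphism G f"
  then have f: "f \<in> hom G G" and bij: "bij_betw f (carrier G) (carrier G)"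
    and inva: "\<And>x. x \<in> carrier G \<Longrightarrow> inv_into (carrier G) f x = inv (f x)"
    by (auto simp: inverse_ambiguous_automorphism_def inverse_ambiguous_def iso_def)
  interpret f: group_hom G G f by unfold_locales (rule f)
  have "f (f x) = inv x" if x: "x \<in> carrier G" for x
  proof -
    have "f (inv (f x)) = x"
      using bij_betw_inv_into_right[OF bij x] inva[OF x] by simp
    then have "inv (f (f x)) = x" using x by simp
    then show ?thesis using x by (metis f.hom_closed inv_inv)
  qed
  then show "f \<in> hom G G \<and> (\<forall>x\<in>carrier G. f (f x) = inv x)" using f by blast
next
  assume *: "f \<in> hom G G \<and> (\<forall>x\<in>carrier G. f (f x) = inv x)"
  interpret f: group_hom G G f by unfold_locales (use * in blast)
  have inv: "f (inv (f x)) = x" if "x \<in> carrier G" for x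
    using * that by simp
  have bij: "bij_betw f (carrier G) (carrier G)"
  proof (rule bij_betw_byWitness[where f' = "\<lambda>x. inv (f x)"])
    show "\<forall>x\<in>carrier G. inv (f (f x)) = x" using * by simp
  qed (use inv in auto)
  moreover have "inv_into (carrier G) f x = inv (f x)" if "x \<in> carrier G" for x
    using bij inv that by (metis bij_betw_imp_inj_on f.hom_closed inv_closed inv_into_f_f)
  ultimately show "inverse_ambiguous_automorphism G f"
    using * by (auto simp: inverse_ambiguous_automorphism_def inverse_ambiguous_def iso_def)
qed

text \<open>Inversion equals \<open>f\<close> applied twice, hence is a homomorphism as well as an
  antihomomorphism.\<close>

lemma inverse_ambiguous_automorphism_commute:
  assumes "inverse_ambiguous_automorphism G f" "x \<in> carrier G" "y \<in> carrier G"
  shows "x \<otimes> y = y \<otimes> x"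
proof -
  have f: "f \<in> hom G G" and ff: "\<And>z. z \<in> carrier G \<Longrightarrow> f (f z) = inv z"
    using assms by (auto simp: inverse_ambiguous_automorphism_iff)
  interpret f: group_hom G G f by unfold_locales (rule f)
  have "inv (x \<otimes> y) = f (f (x \<otimes> y))" by (simp add: ff assms del: f.hom_mult)
  also have "\<dots> = f (f x) \<otimes> f (f y)" using assms by simp
  also have "\<dots> = inv (y \<otimes> x)" using ff assms by (simp add: inv_mult_group)
  finally show ?thesis using assms by (metis inv_inv m_closed)
qed

text \<open>On the cyclic group, \<open>f\<close> sends the generator to some power with exponent
  \<open>k\<close>; applying \<open>f\<close> twice gives exponent \<open>k * k\<close>, which must
  act as \<open>-1\<close>.\<close>

lemma ord_dvd_square_plus_one:
  assumes x: "x \<in> carrier G" "ord x > 0"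
    and f: "inverse_ambiguous_automorphism (G\<lparr>carrier := generate G {x}\<rparr>) f"
  shows "\<exists>k. ord x dvd k\<^sup>2 + 1"
proof -
  let ?C = "generate G {x}"
  have sub: "subgroup ?C G" using x by (intro generate_is_subgroup) auto
  interpret C: group "G\<lparr>carrier := ?C\<rparr>" by (rule subgroup_imp_group[OF sub])
  have hom: "f \<in> hom (G\<lparr>carrier := ?C\<rparr>) (G\<lparr>carrier := ?C\<rparr>)"
    and ff: "\<And>z. z \<in> ?C \<Longrightarrow> f (f z) = inv z"
    using f sub by (auto simp: C.inverse_ambiguous_automorphism_iff m_inv_consistent)
  interpret f: group_hom "G\<lparr>carrier := ?C\<rparr>" "G\<lparr>carrier := ?C\<rparr>" f
    by unfold_locales (rule hom)
  have xC: "x \<in> ?C" by (simp add: generate.incl)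
  have "f x \<in> ?C" using f.hom_closed xC by simp
  then obtain k :: nat where k: "f x = x [^] k" using generate_pow_nat x by auto
  have "f (x [^] k) = (f x) [^] k"
    using f.hom_nat_pow[of x k] xC by (simp flip: nat_pow_consistent)
  then have "x [^] (k * k) = inv x" using k ff[OF xC] x by (simp add: nat_pow_pow)
  then have "x [^] (k\<^sup>2 + 1) = \<one>" using x by (simp add: power2_eq_square)
  then show ?thesis using pow_eq_id x by blast
qed

end

lemma (in comm_group) inverse_ambiguous_power_automorphism:
  assumes ord: "\<And>x. x \<in> carrier G \<Longrightarrow> ord x > 0 \<and> (\<exists>k. ord x dvd k\<^sup>2 + 1)"
  shows "\<exists>\<alpha>. inverse_ambiguous_automorphism G \<alpha> \<and> (\<forall>H. subgroup H G \<longrightarrow> \<alpha> ` H = H)"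
proof -
  obtain r :: "nat \<Rightarrow> nat" where r: "\<And>n k. n > 0 \<Longrightarrow> n dvd k\<^sup>2 + 1 \<Longrightarrow>
      n dvd (r n)\<^sup>2 + 1 \<and> (\<forall>m. m dvd n \<longrightarrow> [r n = r m] (mod m))"
    using compatible_square_roots by blast
  define \<alpha> where "\<alpha> x = x [^] r (ord x)" for x
  \<comment> \<open>Compatibility of the roots allows one exponent to serve all elements whose
    orders divide a common admissible \<open>n\<close>.\<close>
  have \<alpha>_eq: "\<alpha> x = x [^] r n"
    if "x \<in> carrier G" "n > 0" "n dvd k\<^sup>2 + 1" "ord x dvd n" for x n k
  proof -
    have "[r n = r (ord x)] (mod ord x)" using r that by blast
    then have "int (ord x) dvd int (r n) - int (r (ord x))"
      by (simp flip: cong_int_iff add: cong_iff_dvd_diff)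
    then have "x [^] int (r (ord x)) = x [^] int (r n)"
      using that by (simp add: int_pow_eq)
    then show ?thesis by (simp add: \<alpha>_def int_pow_int)
  qed
  have mult: "\<alpha> (x \<otimes> y) = \<alpha> x \<otimes> \<alpha> y" if xy: "x \<in> carrier G" "y \<in> carrier G" for x y
  proof -
    \<comment> \<open>This modulus is admissible and is a multiple of the orders of
      \<open>x\<close>, \<open>y\<close> and their product, so \<alpha> is the same power map on all
      three.\<close>
    let ?n = "lcm (ord x) (ord y)"
    have pos: "?n > 0" using ord xy by (simp add: lcm_pos_nat)
    obtain k where k: "?n dvd k\<^sup>2 + 1"
      using ord xy square_root_minus_one_lcm by meson
    have "x [^] ?n = \<one>" "y [^] ?n = \<one>" using xy pow_eq_id by auto
    then have "(x \<otimes> y) [^] ?n = \<one>" using xy by (simp add: nat_pow_distrib)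
    then have "ord (x \<otimes> y) dvd ?n" using xy by (simp add: pow_eq_id)
    then show ?thesis
      using \<alpha>_eq[OF _ pos k] xy by (simp add: nat_pow_distrib)
  qed
  have closed: "\<alpha> x \<in> H" if "subgroup H G" "x \<in> H" for H x
    unfolding \<alpha>_def using that by (metis int_pow_int subgroup_int_pow_closed)
  have inv: "\<alpha> (\<alpha> x) = inv x" if x: "x \<in> carrier G" for x
  proof -
    let ?n = "ord x"
    obtain k where k: "?n > 0" "?n dvd k\<^sup>2 + 1" using ord x by blast
    have "(x [^] r ?n) [^] ?n = \<one>"
      using x by (metis nat_pow_pow nat_pow_one mult.commute pow_ord_eq_1)
    then have "ord (x [^] r ?n) dvd ?n" using x by (simp add: pow_eq_id)
    then have "\<alpha> (x [^] r ?n) = (x [^] r ?n) [^] r ?n"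
      using \<alpha>_eq[OF _ k] x by blast
    then have "\<alpha> (\<alpha> x) = x [^] (r ?n * r ?n)"
      using x by (simp only: \<alpha>_def[of x] nat_pow_pow)
    moreover have "x [^] (r ?n * r ?n) \<otimes> x = \<one>"
    proof -
      have "x [^] ((r ?n)\<^sup>2 + 1) = \<one>" using r k x pow_eq_id by blast
      then show ?thesis by (simp add: power2_eq_square)
    qed
    ultimately show ?thesis using x by (metis inv_equality nat_pow_closed)
  qed
  have "\<alpha> \<in> hom G G"
    using mult closed[OF subgroup_self] by (auto simp: hom_def)
  then have "inverse_ambiguous_automorphism G \<alpha>"
    using inv by (simp add: inverse_ambiguous_automorphism_iff)
  moreover have "\<alpha> ` H = H" if H: "subgroup H G" for H
  proof
    show "\<alpha> ` H \<subseteq> H" using closed[OF H] by blast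
    show "H \<subseteq> \<alpha> ` H"
    proof
      fix x assume x: "x \<in> H"
      \<comment> \<open>The preimage of \<open>x\<close> is \<open>\<alpha> (inv x)\<close>, which
        stays in \<open>H\<close>.\<close>
      then have "x = \<alpha> (\<alpha> (inv x))"
        using inv H by (metis inv_closed inv_inv subgroup.mem_carrier)
      then show "x \<in> \<alpha> ` H"
        using closed[OF H] subgroup.m_inv_closed[OF H x] by blast
    qed
  qed
  ultimately show ?thesis by blast
qed

theorem theorem5p3:
  fixes G :: "('a, 'b) monoid_scheme"
  assumes "group G"
    and "infinite (carrier G)"
    and "locally_finite G"
    and "\<And>H. subgroup H G \<Longrightarrow> H \<noteq> carrier G \<Longrightarrow>
           \<exists>f. inverse_ambiguous_automorphism (G\<lparr>carrier := H\<rparr>) f"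
  shows "(\<exists>\<alpha>. inverse_ambiguous_automorphism G \<alpha> \<and>
            (\<forall>H. subgroup H G \<longrightarrow> \<alpha> ` H = H)) \<and>
         comm_group G"
proof -
  interpret group G by fact
  have fin: "finite (generate G S)" if "finite S" "S \<subseteq> carrier G" for S
    using that assms(3) unfolding locally_finite_def by blast
  \<comment> \<open>A finitely generated subgroup is finite, hence proper in the infinite group
    \<open>G\<close>.\<close>
  have ex: "\<exists>f. inverse_ambiguous_automorphism (G\<lparr>carrier := generate G S\<rparr>) f"
    if "finite S" "S \<subseteq> carrier G" for S
    using assms(2,4) fin[OF that] generate_is_subgroup[OF that(2)] by metis
  have "x \<otimes>\<^bsub>G\<^esub> y = y \<otimes>\<^bsub>G\<^esub> x" if xy: "x \<in> carrier G" "y \<in> carrier G" for x y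
  proof -
    let ?H = "generate G {x, y}"
    interpret H: group "G\<lparr>carrier := ?H\<rparr>"
      using xy by (intro subgroup_imp_group generate_is_subgroup) auto
    obtain f where "inverse_ambiguous_automorphism (G\<lparr>carrier := ?H\<rparr>) f"
      using ex[of "{x, y}"] xy by blast
    from H.inverse_ambiguous_automorphism_commute[OF this, of x y] show ?thesis
      by (simp add: generate.incl)
  qed
  then have comm: "comm_group G" by (intro group_comm_groupI)
  then interpret comm_group G .
  have "ord x > 0 \<and> (\<exists>k. ord x dvd k\<^sup>2 + 1)" if x: "x \<in> carrier G" for x
  proof
    have "finite (generate G {x})" using fin x by simp
    \<comment> \<open>\<open>ord x\<close> is \<open>0\<close> exactly when \<open>x\<close> has
      infinite order.\<close>
    then show "ord x > 0"
      using x finite_cyclic_subgroup_order[OF x]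
      by (simp add: subgroup_generated_def)
    then show "\<exists>k. ord x dvd k\<^sup>2 + 1"
      using ord_dvd_square_plus_one[OF x] ex[of "{x}"] x by auto
  qed
  then show ?thesis using inverse_ambiguous_power_automorphism comm by blast
qed

end
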